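(* Let $S=(a_h)_{h\in\mathbb{Z}}$ be a complete folding sequence, let $T$ be a finite subword of $S$, and let $r\in\mathbb{N}$ satisfy $|T|\le 2^r$. Then for every $h\in\mathbb{Z}$, $T$ is a subword of $(a_{h+1},\dots,a_{h+10\cdot 2^r-2})$.
   Context: All sequences take values in $\{+1,-1\}$; $|T|$ denotes the length of a finite sequence $T$. For $S=(a_1,\dots,a_n)$ write $\overline{S}=(-a_n,\dots,-a_1)$. The $n$-folding sequences are defined recursively: the only $0$-folding sequence is the empty sequence, and the $(n+1)$-folding sequences are exactly $(\overline{S},+1,S)$ and $(\overline{S},-1,S)$ with $S$ an $n$-folding sequence. A finite sequence $(u_1,\dots,u_m)$ is a subword of a sequence $(b_k)$ if there is $h$ with $u_k=b_{k+h}$ for $1\le k\le m$. A complete folding sequence is a sequence $(a_k)_{k\in\mathbb{Z}}$ each finite subword of which is a subword of some $n$-folding sequence. *)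

theory Defs
  imports Main "HOL-Library.Sublist"
begin

definition fold_bar :: "int list \<Rightarrow> int list" where
  "fold_bar S = map uminus (rev S)"

inductive folding :: "nat \<Rightarrow> int list \<Rightarrow> bool" where
  folding_0: "folding 0 []"
| folding_plus: "folding n S \<Longrightarrow> folding (Suc n) (fold_bar S @ [1] @ S)"
| folding_minus: "folding n S \<Longrightarrow> folding (Suc n) (fold_bar S @ [-1] @ S)"

text \<open>Subwords of finite sequences are the library's contiguous sublists (\<^const>\<open>sublist\<close>).
  List positions count from 0, hence the shift \<open>h + 1 + k\<close> below.\<close>

definition subword_Z :: "int list \<Rightarrow> (int \<Rightarrow> int) \<Rightarrow> bool" where
  "subword_Z u b \<longleftrightarrow> (\<exists>h::int. \<forall>k<length u. u ! k = b (h + 1 + int k))"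

definition complete_folding :: "(int \<Rightarrow> int) \<Rightarrow> bool" where
  "complete_folding a \<longleftrightarrow>
     (\<forall>k. a k \<in> {1, -1}) \<and>
     (\<forall>u. subword_Z u a \<longrightarrow> (\<exists>n S. folding n S \<and> sublist u S))"

end

theory Submission
  imports Defs
begin

text \<open>In an \<open>n\<close>-folding sequence the entry at position \<open>2^i * m\<close> (positions counted from 1, \<open>m\<close>
  odd) is a sign depending only on \<open>i\<close>, multiplied by \<open>1\<close> or \<open>-1\<close> according to \<open>m mod 4\<close>. Hence the
  entries at positions not divisible by \<open>2^r\<close> have period \<open>2^(r+1)\<close>, and a word \<open>T\<close> with
  \<open>|T| \<le> 2^r\<close> covers at most one other position. Among any four consecutive translates of that
  position by \<open>2^(r+1)\<close>, two carry opposite signs, so \<open>T\<close> reappears at one of four consecutive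
  translates. Any finite part of a complete folding sequence, in particular one containing both
  \<open>T\<close> and the prescribed window, lies inside a single finite folding sequence.\<close>

section \<open>The nontrivial Dirichlet character modulo 4, set to -1 at even arguments\<close>

definition chi4 :: "nat \<Rightarrow> int" where
  "chi4 m = (if m mod 4 = 1 then 1 else -1)"

lemma chi4_add_mult_4: "chi4 (m + 4 * d) = chi4 m"
  by (simp add: chi4_def)

lemma chi4_add_2:
  assumes "odd m"
  shows "chi4 (m + 2) = - chi4 m"
proof -
  have "(m + 2) mod 4 = 1 \<longleftrightarrow> m mod 4 \<noteq> 1" using assms by presburger
  then show ?thesis by (simp add: chi4_def)
qed

text \<open>Negation swaps the residues 1 and 3 modulo 4. The resulting sign cancels the negation in
  \<open>fold_bar\<close>.\<close>

lemma chi4_reflect: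
  assumes "odd m" "m < 4 * d"
  shows "chi4 (4 * d - m) = - chi4 m"
proof -
  define k where "k = 4 * d - m"
  have "(m + k) mod 4 = 0" using assms(2) by (simp add: k_def)
  then have "k mod 4 = 1 \<longleftrightarrow> m mod 4 \<noteq> 1" using assms(1) by presburger
  then show ?thesis by (simp add: chi4_def k_def)
qed

lemma nat_eq_power2_times_odd:
  fixes k :: nat
  assumes "k > 0"
  obtains i m where "k = 2 ^ i * m" "odd m"
  using assms
proof (induction k arbitrary: thesis rule: less_induct)
  case (less k)
  show ?case
  proof (cases "odd k")
    case True
    then show ?thesis using less.prems(1)[of 0 k] by simp
  next
    case False
    then obtain k' where k: "k = 2 * k'" by blast
    with less.prems(2) have "k' < k" "k' > 0" by auto
    then obtain i m where "k' = 2 ^ i * m" "odd m" using less.IH by blast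
    then show ?thesis using less.prems(1)[of "Suc i" m] k by simp
  qed
qed

section \<open>Toeplitz structure of finite folding sequences\<close>

lemma length_folding: "folding n S \<Longrightarrow> length S = 2 ^ n - 1"
proof (induction rule: folding.induct)
  case (folding_plus n S)
  moreover have "(2::nat) ^ n \<ge> 1" by simp
  ultimately show ?case by (simp add: fold_bar_def del: one_le_power)
next
  case (folding_minus n S)
  moreover have "(2::nat) ^ n \<ge> 1" by simp
  ultimately show ?case by (simp add: fold_bar_def del: one_le_power)
qed simp

lemma set_folding: "folding n S \<Longrightarrow> set S \<subseteq> {1, -1}"
  by (induction rule: folding.induct) (auto simp: fold_bar_def)

text \<open>The value \<open>e i\<close> is the sign of level \<open>i\<close>, the set of positions
  exactly divisible by \<open>2 ^ i\<close>. The \<open>- 1\<close> turns a position counted from 1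
  into a list index.\<close>

definition toeplitz :: "nat \<Rightarrow> int list \<Rightarrow> (nat \<Rightarrow> int) \<Rightarrow> bool" where
  "toeplitz n S e \<longleftrightarrow>
     (\<forall>i m. odd m \<longrightarrow> 2 ^ i * m < 2 ^ n \<longrightarrow> S ! (2 ^ i * m - 1) = e i * chi4 m)"

text \<open>The new centre is at position \<open>2 ^ n\<close>. A position \<open>k\<close> to its
  left is read off at \<open>2 ^ n - k\<close> with a minus sign, one to its right at
  \<open>k - 2 ^ n\<close>; both moves preserve the level, and if \<open>i + 1 < n\<close> they act
  on \<open>m\<close> by reflection or translation modulo 4.\<close>

lemma toeplitz_step:
  assumes len: "length S = 2 ^ n - 1" and S: "toeplitz n S e"
  shows "\<exists>e'. toeplitz (Suc n) (fold_bar S @ [c] @ S) e'"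
proof
  \<comment> \<open>For \<open>i + 1 = n\<close> the shift by \<open>2^n\<close> changes \<open>m\<close> by 2, which flips the sign.\<close>
  define e' where "e' = (\<lambda>i. if i = n then c else if Suc i = n then - e i else e i)"
  have len_bar: "length (fold_bar S) = 2 ^ n - 1" using len by (simp add: fold_bar_def)
  show "toeplitz (Suc n) (fold_bar S @ [c] @ S) e'"
    unfolding toeplitz_def
  proof (intro allI impI)
    fix i m :: nat
    assume m: "odd m" and lt: "2 ^ i * m < 2 ^ Suc n"
    define k where "k = 2 ^ i * m"
    have "m > 0" using m by (cases m) auto
    then have k0: "k > 0" by (simp add: k_def)
    have "2 ^ i < (2::nat) ^ Suc n"
      using lt \<open>m > 0\<close> by (metis le_less_trans mult.right_neutral mult_le_mono2 Suc_leI One_nat_def)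
    then have "i < Suc n" using power_less_imp_less_exp[of "2::nat" i "Suc n"] by simp
    then consider "i = n" | "i < n" by linarith
    then have "(fold_bar S @ [c] @ S) ! (k - 1) = e' i * chi4 m"
    proof cases
      case 1
      then have "m < 2" using lt by simp
      then have "m = 1" using \<open>m > 0\<close> by simp
      then show ?thesis using 1 by (simp add: k_def e'_def chi4_def nth_append len_bar)
    next
      case 2
      \<comment> \<open>The centre is \<open>2 ^ i * (2 * d)\<close>, so \<open>m\<close> is
        compared with \<open>2 * d\<close>; this is a multiple of 4 unless
        \<open>i + 1 = n\<close>.\<close>
      obtain d where d: "2 ^ n = 2 ^ i * (2 * d :: nat)" and d2: "Suc i < n \<longrightarrow> even d"
        and d1: "Suc i = n \<longrightarrow> d = 1"
      proof
        have n: "n = i + Suc (n - Suc i)" using 2 by simp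
        show "2 ^ n = 2 ^ i * (2 * 2 ^ (n - Suc i) :: nat)"
          by (subst n) (simp only: power_add power_Suc)
      qed auto
      have mne: "m \<noteq> 2 * d" using m by auto
      show ?thesis
      proof (cases "m < 2 * d")
        case True
        then have "k < 2 ^ n" by (simp add: k_def d)
        then have "(fold_bar S @ [c] @ S) ! (k - 1) = - S ! (2 ^ n - k - 1)"
        proof -
          have "k - 1 < 2 ^ n - 1" using k0 \<open>k < 2 ^ n\<close> by linarith
          moreover from this have "2 ^ n - 1 - Suc (k - 1) = 2 ^ n - k - 1" using k0 by linarith
          ultimately show ?thesis using len by (simp add: nth_append fold_bar_def rev_nth)
        qed
        also have "2 ^ n - k = 2 ^ i * (2 * d - m)" by (simp add: k_def d diff_mult_distrib2)
        also have "S ! (2 ^ i * (2 * d - m) - 1) = e i * chi4 (2 * d - m)"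
          using S True m \<open>m > 0\<close> unfolding toeplitz_def d by simp
        finally have *: "(fold_bar S @ [c] @ S) ! (k - 1) = - (e i * chi4 (2 * d - m))" .
        show ?thesis
        proof (cases "Suc i = n")
          case True
          \<comment> \<open>At level \<open>n - 1\<close> the left half has a single position, which
            the reflection fixes; only the minus sign remains.\<close>
          then have "m = 1" "d = 1" using d1 \<open>m < 2 * d\<close> \<open>m > 0\<close> by auto
          then show ?thesis using * True by (auto simp: e'_def)
        next
          case False
          then obtain d' where "d = 2 * d'" using 2 d2 by auto
          then show ?thesis using * False 2 m \<open>m < 2 * d\<close> chi4_reflect[of m d']
            by (simp add: e'_def)
        qed
      next
        case False
        with mne have gt: "m > 2 * d" by simp
        then have "k > 2 ^ n" by (simp add: k_def d)
        then have "(fold_bar S @ [c] @ S) ! (k - 1) = S ! (k - 2 ^ n - 1)"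
          using len_bar
          by (auto simp: nth_append nth_Cons' not_less intro!: arg_cong[of _ _ "nth S"])
        also have "k - 2 ^ n = 2 ^ i * (m - 2 * d)" by (simp add: k_def d diff_mult_distrib2)
        also have "S ! (2 ^ i * (m - 2 * d) - 1) = e i * chi4 (m - 2 * d)"
        proof -
          have "2 ^ i * m < 2 ^ i * (4 * d)" using lt d by simp
          then have "m < 4 * d" by simp
          then have "2 ^ i * (m - 2 * d) < 2 ^ n" unfolding d using gt by simp
          then show ?thesis using S m gt unfolding toeplitz_def by simp
        qed
        finally have *: "(fold_bar S @ [c] @ S) ! (k - 1) = e i * chi4 (m - 2 * d)" .
        show ?thesis
        proof (cases "Suc i = n")
          case True
          then have "d = 1" using d1 by simp
          with gt have "m - 2 + 2 = m" by simp
          then have "chi4 m = - chi4 (m - 2)"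
            using chi4_add_2[of "m - 2"] m by (metis even_add even_numeral)
          then show ?thesis using * True \<open>d = 1\<close> by (auto simp: e'_def)
        next
          case False
          then obtain d' where "d = 2 * d'" using 2 d2 by auto
          then show ?thesis using * False 2 gt chi4_add_mult_4[of "m - 2 * d" d']
            by (simp add: e'_def)
        qed
      qed
    qed
    then show "(fold_bar S @ [c] @ S) ! (2 ^ i * m - 1) = e' i * chi4 m"
      by (simp add: k_def)
  qed
qed

lemma folding_toeplitz: "folding n S \<Longrightarrow> \<exists>e. toeplitz n S e"
proof (induction rule: folding.induct)
  case folding_0
  then show ?case by (auto simp: toeplitz_def)
next
  case (folding_plus n S)
  then show ?case using toeplitz_step length_folding by blast
next
  case (folding_minus n S)
  then show ?case using toeplitz_step length_folding by blast
qed

section \<open>Periodicity and sign changes along arithmetic progressions\<close>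

lemma folding_periodic:
  assumes "folding n S" and k: "\<not> 2 ^ r dvd k" and lt: "k + 2 ^ Suc r * d < 2 ^ n"
  shows "S ! (k + 2 ^ Suc r * d - 1) = S ! (k - 1)"
proof -
  obtain e where e: "toeplitz n S e" using folding_toeplitz assms(1) by blast
  have "k > 0" using k by (cases k) auto
  then obtain i m where km: "k = 2 ^ i * m" "odd m" using nat_eq_power2_times_odd by blast
  with k have "i < r" by (metis dvd_mult2 le_imp_power_dvd not_less)
  \<comment> \<open>As \<open>i < r\<close>, the period is a multiple of \<open>4 * 2 ^ i\<close>,
    so a translation keeps both the level and \<open>m mod 4\<close>.\<close>
  then have "Suc r = i + (2 + (r - Suc i))" by simp
  then have "(2::nat) ^ Suc r = 2 ^ i * (4 * 2 ^ (r - Suc i))"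
    by (simp only: power_add) (simp add: power_add power2_eq_square)
  then have eq: "k + 2 ^ Suc r * d = 2 ^ i * (m + 4 * (2 ^ (r - Suc i) * d))"
    by (simp add: km algebra_simps)
  have "S ! (k + 2 ^ Suc r * d - 1) = e i * chi4 (m + 4 * (2 ^ (r - Suc i) * d))"
    using e lt km(2) unfolding eq toeplitz_def by simp
  moreover have "S ! (k - 1) = e i * chi4 m"
    using e lt km unfolding toeplitz_def by auto
  ultimately show ?thesis by (simp add: chi4_add_mult_4)
qed

lemma folding_periodic_cong:
  assumes S: "folding n S" and k: "\<not> 2 ^ r dvd k" and "k < 2 ^ n" "l < 2 ^ n"
    and mod: "k mod 2 ^ Suc r = l mod 2 ^ Suc r"
  shows "S ! (k - 1) = S ! (l - 1)"
proof -
  have l: "\<not> 2 ^ r dvd l"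
  proof
    assume "2 ^ r dvd l"
    moreover have "(2::nat) ^ r dvd 2 ^ Suc r" by simp
    ultimately have "2 ^ r dvd k" using mod by (metis dvd_mod_iff)
    with k show False ..
  qed
  show ?thesis
  proof (cases "k \<le> l")
    case True
    then have "2 ^ Suc r dvd l - k" using mod by (metis mod_eq_dvd_iff_nat)
    then obtain d where "l - k = 2 ^ Suc r * d" by blast
    with True have "l = k + 2 ^ Suc r * d" by linarith
    then show ?thesis using folding_periodic[OF S k] assms(4) by simp
  next
    case False
    then have "2 ^ Suc r dvd k - l" using mod by (metis mod_eq_dvd_iff_nat nat_le_linear)
    then obtain d where "k - l = 2 ^ Suc r * d" by blast
    with False have "k = l + 2 ^ Suc r * d" by linarith
    then show ?thesis using folding_periodic[OF S l] assms(3) by simp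
  qed
qed

lemma folding_opposite:
  assumes "folding n S" and "odd m" and "2 ^ i * (m + 2) < 2 ^ n"
  shows "S ! (2 ^ i * (m + 2) - 1) = - S ! (2 ^ i * m - 1)"
proof -
  obtain e where e: "toeplitz n S e" using folding_toeplitz assms(1) by blast
  have "S ! (2 ^ i * (m + 2) - 1) = e i * chi4 (m + 2)"
    using e[unfolded toeplitz_def, rule_format, of "m + 2" i] assms(2,3) by simp
  moreover have "2 ^ i * m < 2 ^ n" using assms(3) by (simp add: algebra_simps)
  then have "S ! (2 ^ i * m - 1) = e i * chi4 m"
    using e assms(2) unfolding toeplitz_def by simp
  ultimately show ?thesis using chi4_add_2[OF assms(2)] by simp
qed

text \<open>If \<open>l\<close> is an odd multiple of \<open>2 ^ r\<close>, the translates
  \<open>t = 0\<close> and \<open>t = 1\<close> are neighbours in level \<open>r\<close> and have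
  opposite signs. Otherwise the translates are consecutive multiples of \<open>2 ^ Suc r\<close>;
  every other one lies in level \<open>r + 1\<close>, so \<open>t\<close> and \<open>t + 2\<close>
  serve for some \<open>t < 2\<close>.\<close>

lemma folding_attains:
  assumes S: "folding n S" and dvd: "2 ^ r dvd l" and "l > 0"
    and lt: "l + 2 ^ Suc r * 3 < 2 ^ n" and x: "x \<in> {1, -1}"
  shows "\<exists>t<4. S ! (l + 2 ^ Suc r * t - 1) = x"
proof -
  have "\<exists>t<4. \<exists>t'<4. S ! (l + 2 ^ Suc r * t' - 1) = - S ! (l + 2 ^ Suc r * t - 1)"
  proof (cases "2 ^ Suc r dvd l")
    case True
    then obtain m where m: "l = 2 ^ Suc r * m" by blast
    obtain t where t: "t < 2" "odd (m + t)"
      by (metis One_nat_def even_plus_one_iff less_2_cases_iff add.right_neutral)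
    have "l + 2 ^ Suc r * (t + 2) \<le> l + 2 ^ Suc r * 3" using t by simp
    moreover have "2 ^ Suc r * (m + t + 2) = l + 2 ^ Suc r * (t + 2)"
      unfolding m by (simp only: add.assoc distrib_left)
    ultimately have "2 ^ Suc r * (m + t + 2) < 2 ^ n" using lt by linarith
    from folding_opposite[OF S t(2) this]
    have "S ! (l + 2 ^ Suc r * (t + 2) - 1) = - S ! (l + 2 ^ Suc r * t - 1)"
      unfolding m by (simp add: algebra_simps)
    then show ?thesis using t(1) by (intro exI[of _ t] conjI exI[of _ "t + 2"]) auto
  next
    case False
    obtain m where m: "l = 2 ^ r * m" using dvd by blast
    with False have "odd m" by auto
    moreover have "2 ^ r * (m + 2) < 2 ^ n" using lt unfolding m by (simp add: algebra_simps)
    ultimately have "S ! (2 ^ r * (m + 2) - 1) = - S ! (2 ^ r * m - 1)"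
      by (rule folding_opposite[OF S])
    moreover have "2 ^ r * (m + 2) = l + 2 ^ Suc r * 1" unfolding m by simp
    ultimately have "S ! (l + 2 ^ Suc r * 1 - 1) = - S ! (l + 2 ^ Suc r * 0 - 1)"
      using m by (metis mult_0_right add_0_right)
    then show ?thesis by (intro exI[of _ 0] conjI exI[of _ 1]) auto
  qed
  then obtain t t' where t: "t < 4" "t' < 4"
    "S ! (l + 2 ^ Suc r * t' - 1) = - S ! (l + 2 ^ Suc r * t - 1)" by blast
  have "l + 2 ^ Suc r * t \<le> l + 2 ^ Suc r * 3" using t(1) by simp
  then have "l + 2 ^ Suc r * t - 1 < length S"
    using lt length_folding[OF S] \<open>l > 0\<close> by linarith
  then have "S ! (l + 2 ^ Suc r * t - 1) \<in> {1, -1}"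
    using set_folding[OF S] nth_mem by blast
  then show ?thesis using t x by (metis insertE singletonD minus_minus)
qed

section \<open>Recurrence of words inside one finite folding sequence\<close>

lemma mod_representative_in_interval:
  fixes p q M :: nat
  assumes "M > 0"
  obtains q0 where "q \<le> q0" "q0 < q + M" "q0 mod M = p mod M"
proof
  \<comment> \<open>Modulo \<open>M\<close>, the term \<open>M - q mod M\<close> stands for
    \<open>-q\<close>, so the residue of \<open>p - q\<close> is added to \<open>q\<close>.\<close>
  define q0 where "q0 = q + (p + (M - q mod M)) mod M"
  show "q \<le> q0" "q0 < q + M" using assms by (auto simp: q0_def)
  have "q0 mod M = (q mod M + (p + (M - q mod M))) mod M" by (simp add: q0_def mod_simps)
  also have "q mod M + (p + (M - q mod M)) = p + M"
    using mod_less_divisor[OF assms, of q] by linarith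
  finally show "q0 mod M = p mod M" by simp
qed

lemma folding_recurrent:
  fixes T :: "int list"
  assumes S: "folding n S" and T: "length T \<le> 2 ^ r"
    and p: "p + length T \<le> length S" "\<And>j. j < length T \<Longrightarrow> T ! j = S ! (p + j)"
    and q: "q + (10 * 2 ^ r - 2) \<le> length S"
  shows "\<exists>q'\<ge>q. q' + length T \<le> q + (10 * 2 ^ r - 2) \<and>
    (\<forall>j<length T. S ! (q' + j) = T ! j)"
proof -
  define M :: nat where "M = 2 ^ Suc r"
  have M: "M > 0" "M = 2 * 2 ^ r" by (simp_all add: M_def)
  have r1: "(1::nat) \<le> 2 ^ r" by simp
  have len: "length S < 2 ^ n" using length_folding[OF S] by simp
  obtain q0 where q0: "q \<le> q0" "q0 < q + M" "q0 mod M = p mod M"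
    using mod_representative_in_interval[OF M(1)] .
  \<comment> \<open>The offset of the end from \<open>q\<close> is at most
    \<open>(2 * 2 ^ r - 1) + 6 * 2 ^ r + 2 ^ r\<close>, which is within
    \<open>10 * 2 ^ r - 2\<close> because \<open>2 ^ r\<close> is at least 1.\<close>
  have fits: "q0 + M * t + length T \<le> q + (10 * 2 ^ r - 2)" if "t < 4" for t
  proof -
    have "M * t \<le> M * 3" using that by simp
    then show ?thesis using q0(2) T r1 unfolding M(2) by linarith
  qed
  have regular: "S ! (q0 + M * t + j) = T ! j"
    if "t < 4" "j < length T" "\<not> 2 ^ r dvd p + j + 1" for t j
  proof -
    have "(p + j + 1) mod M = (q0 + M * t + j + 1) mod M"
      by (metis q0(3) mod_add_left_eq mod_mult_self2 add.assoc)
    moreover have "p + j + 1 < 2 ^ n" "q0 + M * t + j + 1 < 2 ^ n"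
      using that fits[OF that(1)] p(1) q len by linarith+
    ultimately have "S ! (p + j + 1 - 1) = S ! (q0 + M * t + j + 1 - 1)"
      using folding_periodic_cong[OF S that(3)] unfolding M_def by blast
    then show ?thesis using p(2)[OF that(2)] by simp
  qed
  have "\<exists>t<4. \<forall>j<length T. S ! (q0 + M * t + j) = T ! j"
  proof (cases "\<exists>j0<length T. 2 ^ r dvd p + j0 + 1")
    case False
    then show ?thesis using regular[of 0] by (intro exI[of _ 0]) auto
  next
    case True
    then obtain j0 where j0: "j0 < length T" "2 ^ r dvd p + j0 + 1" by blast
    \<comment> \<open>Distinct multiples of \<open>2 ^ r\<close> are at least \<open>2 ^ r\<close>
      apart, while indices in \<open>T\<close> differ by less than that.\<close>
    have unique: "j = j0" if "j < length T" "2 ^ r dvd p + j + 1" for j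
    proof -
      have "int (2 ^ r) dvd int (p + j + 1) - int (p + j0 + 1)"
        using that(2) j0(2) by (intro dvd_diff) (simp_all only: int_dvd_int_iff)
      then have "int (2 ^ r) dvd int j - int j0" by simp
      moreover have "\<bar>int j - int j0\<bar> < int (2 ^ r)" using that(1) j0(1) T by linarith
      ultimately show ?thesis using zdvd_imp_le[of "int (2 ^ r)" "\<bar>int j - int j0\<bar>"] by force
    qed
    have "(p + j0 + 1) mod M = (q0 + j0 + 1) mod M"
      by (metis q0(3) mod_add_left_eq add.assoc)
    then have "2 ^ r dvd q0 + j0 + 1"
      using j0(2) dvd_mod_iff[of "2 ^ r" M] M(2) by (metis dvd_triv_right)
    moreover have "q0 + j0 + 1 + 2 ^ Suc r * 3 < 2 ^ n"
      using fits[of 3] j0(1) q len unfolding M_def by linarith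
    moreover have "T ! j0 \<in> {1, -1}"
      using p j0(1) set_folding[OF S] nth_mem[of "p + j0" S] by force
    ultimately obtain t where "t < 4" "S ! (q0 + j0 + 1 + 2 ^ Suc r * t - 1) = T ! j0"
      using folding_attains[OF S, of r "q0 + j0 + 1"] by auto
    then have "t < 4" "S ! (q0 + M * t + j0) = T ! j0"
      by (simp_all add: M_def algebra_simps)
    then show ?thesis using regular unique by metis
  qed
  then obtain t where t: "t < 4" "\<forall>j<length T. S ! (q0 + M * t + j) = T ! j" by blast
  then show ?thesis using fits q0(1) by (intro exI[of _ "q0 + M * t"]) auto
qed

section \<open>Transfer to complete folding sequences\<close>

lemma sublist_if_nth:
  assumes "q + length T \<le> length W" "\<And>j. j < length T \<Longrightarrow> W ! (q + j) = T ! j"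
  shows "sublist T W"
proof -
  have "take (length T) (drop q W) = T" using assms by (intro nth_equalityI) auto
  then show ?thesis by (metis sublist_drop sublist_take sublist_order.order.trans)
qed

theorem theorem1p10:
  fixes a :: "int \<Rightarrow> int" and T :: "int list" and r :: nat and h :: int
  assumes "complete_folding a"
    and "subword_Z T a"
    and "length T \<le> 2 ^ r"
  shows "sublist T (map a [h + 1..h + 10 * 2 ^ r - 2])"
proof -
  \<comment> \<open>The subtraction is not truncated, since \<open>2 ^ r\<close> is at least 1;
    hence \<open>L\<close> is also the length of the integer window.\<close>
  define L :: nat where "L = 10 * 2 ^ r - 2"
  have "(1::nat) \<le> 2 ^ r" by simp
  then have L: "int L = 10 * 2 ^ r - 2" by (simp add: L_def of_nat_diff)
  obtain g where g: "\<And>k. k < length T \<Longrightarrow> T ! k = a (g + 1 + int k)"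
    using assms(2) unfolding subword_Z_def by blast
  \<comment> \<open>The word \<open>u\<close> spans the hull of the given occurrence of
    \<open>T\<close> and the window; \<open>p\<close> and \<open>q\<close> below are their offsets
    in \<open>u\<close>.\<close>
  define lo where "lo = min g h"
  define len where "len = nat (max (g + int (length T)) (h + int L) - lo)"
  define u where "u = map (\<lambda>k. a (lo + 1 + int k)) [0..<len]"
  have u: "length u = len" "\<And>k. k < len \<Longrightarrow> u ! k = a (lo + 1 + int k)"
    by (simp_all add: u_def)
  have "subword_Z u a" using u unfolding subword_Z_def by auto
  then obtain n S where S: "folding n S" "sublist u S"
    using assms(1) unfolding complete_folding_def by blast
  then obtain xs ys where xs: "S = xs @ u @ ys" unfolding sublist_def by blast
  have nth: "S ! (length xs + k) = a (lo + 1 + int k)" if "k < len" for k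
    using that u by (simp add: xs nth_append)
  define p where "p = nat (g - lo)"
  define q where "q = nat (h - lo)"
  have pq: "int p = g - lo" "int q = h - lo" by (simp_all add: p_def q_def lo_def)
  have plen: "p + length T \<le> len" and qlen: "q + L \<le> len"
    using pq unfolding len_def by linarith+
  have "\<exists>q'\<ge>length xs + q. q' + length T \<le> length xs + q + (10 * 2 ^ r - 2) \<and>
      (\<forall>j<length T. S ! (q' + j) = T ! j)"
  proof (rule folding_recurrent[OF S(1) assms(3)])
    show "length xs + p + length T \<le> length S"
      using plen u(1) by (simp add: xs)
    show "length xs + q + (10 * 2 ^ r - 2) \<le> length S"
      using qlen u(1) by (simp add: xs L_def)
    show "T ! j = S ! (length xs + p + j)" if "j < length T" for j
      using nth[of "p + j"] g[OF that] that plen pq(1) by (simp add: add.assoc algebra_simps)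
  qed
  then obtain q' where q': "q' \<ge> length xs + q" "q' + length T \<le> length xs + q + L"
      "\<forall>j<length T. S ! (q' + j) = T ! j"
    unfolding L_def by blast
  \<comment> \<open>The offset \<open>d\<close> of the new occurrence within the window carries it
    from \<open>S\<close> back to \<open>a\<close>.\<close>
  then obtain d where d: "q' = length xs + q + d" using le_Suc_ex by blast
  show ?thesis
  proof (rule sublist_if_nth[of d])
    show len_W: "d + length T \<le> length (map a [h + 1..h + 10 * 2 ^ r - 2])"
      using q'(2) d L by simp
    show "map a [h + 1..h + 10 * 2 ^ r - 2] ! (d + j) = T ! j" if "j < length T" for j
    proof -
      have "d + j < L" using q'(2) d that by simp
      then have "map a [h + 1..h + 10 * 2 ^ r - 2] ! (d + j) = a (h + 1 + int (d + j))"
        using L by simp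
      also have "\<dots> = a (lo + 1 + int (q + d + j))" using pq(2) by (simp add: algebra_simps)
      also have "\<dots> = S ! (length xs + (q + d + j))"
        using nth[of "q + d + j"] \<open>d + j < L\<close> qlen by simp
      also have "\<dots> = T ! j" using q'(3) that d by (simp add: add.assoc)
      finally show ?thesis .
    qed
  qed
qed

end
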